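(* Let $\Gamma$ be a countable group and consider a measure preserving action of $\Gamma$ on a standard probability space $(X,\mu)$ with induced equivalence relation $F=E^X_\Gamma$. (i) If $E\subseteq F$ is a (Borel) subequivalence relation and $\varphi^0_E:=\inf_{\gamma\in\Gamma}\varphi_E(\gamma)>0$, then there is an $E$-invariant Borel set $A\subseteq X$ of positive measure such that $[F|A:E|A]=m$ for some $m\le \frac{1}{\varphi^0_E}$; so that if $\varphi^0_E>\frac12$, then $F|A=E|A$. (ii) If $E$ is any countable, measure preserving equivalence relation on $(X,\mu)$ and $\epsilon>0$, then: if $\varphi_E(\gamma)\ge 1-\epsilon$ for all $\gamma\in\Gamma$, then $\varphi_E(S)\ge 1-4\epsilon$ for all $S\in[F]$.
   Context: A standard probability space is one isomorphic to the unit interval with Lebesgue measure. $\mathrm{Aut}(X,\mu)$ is the group of measure preserving Borel automorphisms of $X$, identified when equal $\mu$-a.e. For an action of a countable group $\Gamma$ on $X$, $E^X_\Gamma$ is the orbit equivalence relation, and $\gamma\in\Gamma$ also denotes the automorphism $x\mapsto\gamma\cdot x$. A Borel equivalence relation $E\subseteq X^2$ is countable if all its classes are countable, and measure preserving if every Borel automorphism $T$ of $X$ with $T(x)\,E\,x$ for all $x$ preserves $\mu$. The full group is $[F]=\{T\in\mathrm{Aut}(X,\mu): T(x)\,F\,x \text{ for } \mu\text{-a.e. } x\}$. For $S\in\mathrm{Aut}(X,\mu)$, $\varphi_E(S)=\mu(\{x: S(x)\,E\,x\})$. $E|A=E\cap A^2$. For $E\subseteq F$, $[F:E]=m$ means every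 $F$-class contains exactly $m$ $E$-classes. All statements are modulo $\mu$-null sets. *)

theory Defs
  imports "HOL-Analysis.Analysis" "HOL-Algebra.Group_Action"
begin

definition borel_iso :: "'a measure \<Rightarrow> 'b measure \<Rightarrow> ('a \<Rightarrow> 'b) \<Rightarrow> bool" where
  "borel_iso M N f \<longleftrightarrow>
     bij_betw f (space M) (space N) \<and> f \<in> measurable M N \<and>
     inv_into (space M) f \<in> measurable N M"

definition measure_iso :: "'a measure \<Rightarrow> 'b measure \<Rightarrow> ('a \<Rightarrow> 'b) \<Rightarrow> bool" where
  "measure_iso M N f \<longleftrightarrow> borel_iso M N f \<and> distr M N f = N"

text \<open>
  The sigma-algebra of a standard probability space is its Borel sigma-algebra (no completion is
  taken), so the model space is the unit interval with the Borel sets and Lebesgue measure.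
\<close>

definition standard_prob_space :: "'a measure \<Rightarrow> bool" where
  "standard_prob_space M \<longleftrightarrow>
     (\<exists>f :: 'a \<Rightarrow> real. measure_iso M (restrict_space lborel {0..1}) f)"

text \<open>
  Representatives of the elements of the automorphism group: no quotient by almost everywhere
  equality is formed.  The notions below depend only on almost everywhere classes.
\<close>

definition Aut :: "'a measure \<Rightarrow> ('a \<Rightarrow> 'a) set" where
  "Aut M = {T. measure_iso M M T}"

definition borel_equiv :: "'a measure \<Rightarrow> 'a rel \<Rightarrow> bool" where
  "borel_equiv M E \<longleftrightarrow> equiv (space M) E \<and> E \<in> sets (M \<Otimes>\<^sub>M M)"

definition countable_equiv :: "'a measure \<Rightarrow> 'a rel \<Rightarrow> bool" where
  "countable_equiv M E \<longleftrightarrow> (\<forall>x\<in>space M. countable (E `` {x}))"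

definition mp_equiv :: "'a measure \<Rightarrow> 'a rel \<Rightarrow> bool" where
  "mp_equiv M E \<longleftrightarrow>
     (\<forall>T. borel_iso M M T \<and> (\<forall>x\<in>space M. (T x, x) \<in> E) \<longrightarrow> distr M M T = M)"

definition full_group :: "'a measure \<Rightarrow> 'a rel \<Rightarrow> ('a \<Rightarrow> 'a) set" where
  "full_group M F = {T \<in> Aut M. AE x in M. (T x, x) \<in> F}"

definition phi :: "'a measure \<Rightarrow> 'a rel \<Rightarrow> ('a \<Rightarrow> 'a) \<Rightarrow> real" where
  "phi M E S = measure M {x \<in> space M. (S x, x) \<in> E}"

definition mp_action :: "('g, 'c) monoid_scheme \<Rightarrow> 'a measure \<Rightarrow> ('g \<Rightarrow> 'a \<Rightarrow> 'a) \<Rightarrow> bool" where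
  "mp_action G M act \<longleftrightarrow>
     group_action G (space M) act \<and> (\<forall>g\<in>carrier G. act g \<in> Aut M)"

definition orbit_equiv ::
    "('g, 'c) monoid_scheme \<Rightarrow> 'a measure \<Rightarrow> ('g \<Rightarrow> 'a \<Rightarrow> 'a) \<Rightarrow> 'a rel" where
  "orbit_equiv G M act = {(x, y). x \<in> space M \<and> y \<in> orbit G act x}"

definition has_index :: "'a set \<Rightarrow> 'a rel \<Rightarrow> 'a rel \<Rightarrow> nat \<Rightarrow> bool" where
  "has_index A F E m \<longleftrightarrow>
     (\<forall>C \<in> A // F. finite {D \<in> A // E. D \<subseteq> C} \<and> card {D \<in> A // E. D \<subseteq> C} = m)"

end

theory Submission
  imports Defs "HOL-Probability.Probability_Measure"
begin

text \<open>
  Consider pairs \<open>(x, C)\<close> of a point \<open>x\<close> and an \<open>E\<close>-class \<open>C\<close> that meets the orbit of \<open>x\<close>, weighted by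
  \<open>\<mu>\<close> in \<open>x\<close> and by counting in \<open>C\<close>.  The group acts on the first coordinate and preserves this
  measure.  The functions \<open>\<xi>\<^sub>\<gamma> (x, C) = 1\<close> if \<open>\<gamma> x \<in> C\<close> and \<open>0\<close> otherwise are unit vectors in the
  associated \<open>L\<^sup>2\<close> space, and the group permutes them.  Their closed convex hull has a unique element
  \<open>f\<close> of least norm, which is therefore invariant: \<open>f (x, C)\<close> depends on \<open>C\<close> alone and defines an
  \<open>E\<close>-invariant function \<open>g\<close> on the space.  Two properties pass from the \<open>\<xi>\<^sub>\<gamma>\<close> to \<open>g\<close>.  Every convex
  combination has fibre sums \<open>\<Sum>\<^sub>C f (x, C) = 1\<close>, so the values of \<open>g\<close> on the distinct \<open>E\<close>-classes of
  one orbit add up to at most 1.  And \<open>\<integral> \<xi>\<^sub>\<gamma> (x, [x]\<^sub>E) d\<mu> = \<phi>\<^sub>E(\<gamma>)\<close>, so \<open>\<integral> g\<close> is at least any lower bound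
  \<open>b\<close> of these numbers.  This is the content of \<open>class_density\<close>; both parts of the theorem follow
  from it.

  For (i), take \<open>b = \<phi>\<^sub>E\<^sup>0\<close>.  The set \<open>B = {g \<ge> b}\<close> is \<open>E\<close>-invariant, has positive measure because
  \<open>\<integral> g \<ge> b\<close>, and meets every orbit in at most \<open>1 / b\<close> classes because these contribute at least \<open>b\<close>
  each to a sum bounded by 1.  The required piece consists of the points of \<open>B\<close> whose orbit
  contains exactly \<open>m\<close> classes of \<open>B\<close>, for a suitable \<open>m\<close> (\<open>finite_index_piece\<close>).

  For (ii), take \<open>b = 1 - \<epsilon>\<close>.  If \<open>S x\<close> lies in the orbit of \<open>x\<close> but not in its \<open>E\<close>-class, then
  \<open>g (S x) + g x \<le> 1\<close>; in all cases the sum is at most 2.  Integrating and using that \<open>S\<close> preserves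
  \<open>\<mu>\<close> gives \<open>2 (1 - \<epsilon>) \<le> 1 + \<phi>\<^sub>E(S)\<close>, hence even \<open>\<phi>\<^sub>E(S) \<ge> 1 - 2 \<epsilon>\<close> (\<open>full_group_phi_ge\<close>).

  The \<open>L\<^sup>2\<close> space itself is never formed.  Finite combinations of the \<open>\<xi>\<^sub>\<gamma>\<close> are lists of weighted group
  elements, their inner products are integrals of explicit finite sums, and the parallelogram law
  shows that near-minimisers are close in mean square.  Choosing a minimising sequence with
  geometric error makes it, and its translates, converge pointwise almost everywhere, which yields
  \<open>g\<close> directly as a function on the original space.
\<close>

section \<open>Almost everywhere summability from fast decay in mean square\<close>

lemma pred_convergent_real:
  fixes f :: "nat \<Rightarrow> 'a \<Rightarrow> real"
  assumes "\<And>n. f n \<in> borel_measurable M"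
  shows "Measurable.pred M (\<lambda>x. convergent (\<lambda>n. f n x))"
  unfolding pred_def Cauchy_convergent_iff[symmetric] using assms by (rule sets_Collect_Cauchy)

text \<open>
  The decay rate is chosen so that \<open>\<bar>u\<bar> \<le> (t + u\<^sup>2 / t) / 2\<close> with \<open>t = 2 / 2\<^sup>n\<close> bounds the first moments
  by the terms of a geometric series.  The majorant \<open>q\<close> of the square will be the squared norm of a
  whole fibre, of which \<open>u\<close> is a single coordinate.
\<close>

lemma (in prob_space) AE_summable_of_second_moments:
  fixes u :: "nat \<Rightarrow> 'a \<Rightarrow> real"
  assumes u: "\<And>n. integrable M (u n)"
    and q: "\<And>n. integrable M (q n)" "\<And>n x. x \<in> space M \<Longrightarrow> (u n x)\<^sup>2 \<le> q n x"
    and bound: "\<And>n. (\<integral>x. q n x \<partial>M) \<le> 4 * (1 / 4) ^ n"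
  shows "AE x in M. summable (\<lambda>n. u n x)"
proof -
  have L1: "(\<integral>x. \<bar>u n x\<bar> \<partial>M) \<le> 2 * (1 / 2) ^ n" for n
  proof -
    define t :: real where "t = 2 * (1 / 2) ^ n"
    have t: "t > 0" by (simp add: t_def)
    have t2: "t * t = 4 * (1 / 4) ^ n"
      unfolding t_def by (simp flip: power_mult_distrib)
    have "(\<integral>x. \<bar>u n x\<bar> \<partial>M) \<le> (\<integral>x. (t + q n x / t) / 2 \<partial>M)"
    proof (rule integral_mono)
      fix x assume x: "x \<in> space M"
      have "0 \<le> (\<bar>u n x\<bar> - t)\<^sup>2" by simp
      also have "\<dots> = (u n x)\<^sup>2 - 2 * t * \<bar>u n x\<bar> + t * t"
        by (simp add: power2_eq_square algebra_simps)
      finally have "2 * t * \<bar>u n x\<bar> \<le> t * t + q n x"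
        using q(2)[OF x, of n] by linarith
      then show "\<bar>u n x\<bar> \<le> (t + q n x / t) / 2"
        using t by (simp add: field_simps)
    qed (use u q in auto)
    also have "\<dots> = (t + (\<integral>x. q n x \<partial>M) / t) / 2"
      using q(1) by (simp add: prob_space)
    also have "\<dots> \<le> (t + t * t / t) / 2"
      using bound[of n] t t2 by (simp add: divide_right_mono)
    finally show ?thesis using t by (simp add: t_def)
  qed
  have "(\<integral>\<^sup>+x. (\<Sum>n. ennreal \<bar>u n x\<bar>) \<partial>M) = (\<Sum>n. \<integral>\<^sup>+x. ennreal \<bar>u n x\<bar> \<partial>M)"
    using u by (intro nn_integral_suminf) auto
  also have "\<dots> = (\<Sum>n. ennreal (\<integral>x. \<bar>u n x\<bar> \<partial>M))"
    using u by (simp add: nn_integral_eq_integral)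
  also have "\<dots> \<le> (\<Sum>n. ennreal (2 * (1 / 2) ^ n))"
    using L1 by (intro suminf_le) (auto simp: ennreal_leI)
  also have "\<dots> < \<infinity>"
  proof -
    have "summable (\<lambda>n. 2 * (1 / 2 :: real) ^ n)"
      by (intro summable_mult summable_geometric) simp
    then show ?thesis
      unfolding infinity_ennreal_def less_top[symmetric] by (rule ennreal_suminf_neq_top) simp
  qed
  finally have "(\<integral>\<^sup>+x. (\<Sum>n. ennreal \<bar>u n x\<bar>) \<partial>M) \<noteq> \<infinity>" by simp
  then have "AE x in M. (\<Sum>n. ennreal \<bar>u n x\<bar>) \<noteq> \<infinity>"
    using u by (intro nn_integral_PInf_AE) auto
  then show ?thesis
  proof eventually_elim
    case (elim x)
    then have "summable (\<lambda>n. \<bar>u n x\<bar>)"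
      by (intro summable_suminf_not_top) auto
    then show ?case by (rule summable_rabs_cancel)
  qed
qed

section \<open>Averages of translates of an equivalence relation\<close>

locale pmp_action_with_relation =
  prob_space M + group_action G "space M" act
  for M :: "'a measure" and G :: "('g, 'c) monoid_scheme" (structure)
    and act :: "'g \<Rightarrow> 'a \<Rightarrow> 'a" +
  fixes E :: "'a rel"
  assumes countable_carrier: "countable (carrier G)"
    and act_Aut: "g \<in> carrier G \<Longrightarrow> act g \<in> Aut M"
    and borel_equiv: "borel_equiv M E"
begin

sublocale group G
  using group_hom group_hom.axioms(1) by blast

lemma act_measurable [measurable]: "g \<in> carrier G \<Longrightarrow> act g \<in> measurable M M"
  using act_Aut by (auto simp: Aut_def measure_iso_def borel_iso_def)

lemma distr_act: "g \<in> carrier G \<Longrightarrow> distr M M (act g) = M"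
  using act_Aut by (auto simp: Aut_def measure_iso_def)

lemma act_space: "g \<in> carrier G \<Longrightarrow> x \<in> space M \<Longrightarrow> act g x \<in> space M"
  by (rule element_image) auto

lemma act_one: "x \<in> space M \<Longrightarrow> act \<one> x = x"
  using id_eq_one by (metis restrict_apply')

lemma equiv_E: "equiv (space M) E" and E_sets [measurable]: "E \<in> sets (M \<Otimes>\<^sub>M M)"
  using borel_equiv by (auto simp: borel_equiv_def)

lemma E_sym: "(x, y) \<in> E \<Longrightarrow> (y, x) \<in> E"
  using equiv_E by (meson equivE symE)

lemma E_trans: "(x, y) \<in> E \<Longrightarrow> (y, z) \<in> E \<Longrightarrow> (x, z) \<in> E"
  using equiv_E by (meson equivE transE)

lemma E_refl: "x \<in> space M \<Longrightarrow> (x, x) \<in> E"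
  using equiv_E by (meson equivE refl_onD)

text \<open>
  A list of pairs \<open>(r, \<gamma>)\<close> stands for the vector \<open>\<Sum> r \<xi>\<^sub>\<gamma>\<close>.  Then \<open>mass L x y\<close> is its coordinate at the
  pair \<open>(x, [y]\<^sub>E)\<close>, \<open>pairing L K x\<close> is the inner product of two such vectors over the fibre of \<open>x\<close>,
  and \<open>energy\<close> is the squared norm.  Lists may repeat group elements, so addition is
  concatenation and needs no normalisation of supports.
\<close>

definition combos :: "(real \<times> 'g) list set" where
  "combos = {L. snd ` set L \<subseteq> carrier G}"

definition mass :: "(real \<times> 'g) list \<Rightarrow> 'a \<Rightarrow> 'a \<Rightarrow> real" where
  "mass L x y = (\<Sum>p\<leftarrow>L. fst p * of_bool ((act (snd p) x, y) \<in> E))"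

definition pairing :: "(real \<times> 'g) list \<Rightarrow> (real \<times> 'g) list \<Rightarrow> 'a \<Rightarrow> real" where
  "pairing L K x = (\<Sum>p\<leftarrow>L. fst p * mass K x (act (snd p) x))"

definition scale :: "real \<Rightarrow> (real \<times> 'g) list \<Rightarrow> (real \<times> 'g) list" where
  "scale t L = map (\<lambda>p. (t * fst p, snd p)) L"

text \<open>Right translation of the labels is how the group acts on these vectors.\<close>

definition shift :: "'g \<Rightarrow> (real \<times> 'g) list \<Rightarrow> (real \<times> 'g) list" where
  "shift a L = map (\<lambda>p. (fst p, snd p \<otimes> a)) L"

definition energy :: "(real \<times> 'g) list \<Rightarrow> real" where
  "energy L = (\<integral>x. pairing L L x \<partial>M)"

text \<open>The convex hull of the vectors \<open>\<xi>\<^sub>\<gamma>\<close>.\<close>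

definition averages :: "(real \<times> 'g) list set" where
  "averages = {L \<in> combos. (\<forall>p\<in>set L. 0 \<le> fst p) \<and> (\<Sum>p\<leftarrow>L. fst p) = 1}"

lemma averages_combos: "L \<in> averages \<Longrightarrow> L \<in> combos"
  by (simp add: averages_def)

lemma mass_append: "mass (L @ K) x y = mass L x y + mass K x y"
  by (simp add: mass_def)

lemma mass_scale: "mass (scale t L) x y = t * mass L x y"
  by (simp add: mass_def scale_def o_def sum_list_const_mult mult.assoc)

lemma pairing_append:
  "pairing (L @ K) J x = pairing L J x + pairing K J x"
  "pairing J (L @ K) x = pairing J L x + pairing J K x"
  by (simp_all add: pairing_def mass_append sum_list_addf distrib_left)

lemma pairing_scale:
  "pairing (scale t L) K x = t * pairing L K x"
  "pairing L (scale t K) x = t * pairing L K x"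
  by (simp_all add: pairing_def mass_scale mult.left_commute sum_list_const_mult)
     (simp add: scale_def o_def mult.assoc sum_list_const_mult)

lemma combos_append: "L \<in> combos \<Longrightarrow> K \<in> combos \<Longrightarrow> L @ K \<in> combos"
  by (auto simp: combos_def)

lemma combos_scale: "L \<in> combos \<Longrightarrow> scale t L \<in> combos"
  by (auto simp: combos_def scale_def)

lemma combos_shift: "a \<in> carrier G \<Longrightarrow> L \<in> combos \<Longrightarrow> shift a L \<in> combos"
  by (auto simp: combos_def shift_def)

lemma averages_shift: "a \<in> carrier G \<Longrightarrow> L \<in> averages \<Longrightarrow> shift a L \<in> averages"
  using combos_shift by (auto simp: averages_def shift_def o_def)

lemma averages_midpoint:
  assumes "L \<in> averages" "K \<in> averages"
  shows "scale (1 / 2) (L @ K) \<in> averages"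
proof -
  have "scale (1 / 2) (L @ K) \<in> combos"
    using assms by (simp add: averages_combos combos_append combos_scale)
  moreover have "(\<Sum>p\<leftarrow>scale t L. fst p) = t * (\<Sum>p\<leftarrow>L. fst p)" for t L
    by (simp add: scale_def o_def sum_list_const_mult)
  moreover have "\<forall>p\<in>set (scale (1 / 2) (L @ K)). 0 \<le> fst p"
    using assms by (auto simp: averages_def scale_def)
  ultimately show ?thesis using assms by (simp add: averages_def)
qed

lemma mass_shift:
  assumes "a \<in> carrier G" "L \<in> combos" "x \<in> space M"
  shows "mass (shift a L) x y = mass L (act a x) y"
proof -
  have "act (snd p \<otimes> a) x = act (snd p) (act a x)" if "p \<in> set L" for p
    using that assms by (intro composition_rule) (auto simp: combos_def)
  then show ?thesis
    by (auto simp: mass_def shift_def o_def intro!: arg_cong[where f = sum_list] map_cong)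
qed

lemma pairing_shift:
  assumes "a \<in> carrier G" "L \<in> combos" "x \<in> space M"
  shows "pairing (shift a L) (shift a L) x = pairing L L (act a x)"
proof -
  have "act (snd p \<otimes> a) x = act (snd p) (act a x)" if "p \<in> set L" for p
    using that assms by (intro composition_rule) (auto simp: combos_def)
  then have "pairing (shift a L) K x = (\<Sum>p\<leftarrow>L. fst p * mass K x (act (snd p) (act a x)))" for K
    unfolding pairing_def
    by (auto simp: shift_def o_def intro!: arg_cong[where f = sum_list] map_cong)
  from this[of "shift a L"] show ?thesis
    by (simp add: mass_shift[OF assms] pairing_def[of L L])
qed

lemma mass_cong:
  assumes "(y, z) \<in> E"
  shows "mass L x y = mass L x z"
proof -
  have "(w, y) \<in> E \<longleftrightarrow> (w, z) \<in> E" for w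
    using assms E_sym E_trans by blast
  then show ?thesis by (simp add: mass_def)
qed

text \<open>
  Grouping the double sum \<open>pairing L L x\<close> by the \<open>E\<close>-classes of the points \<open>\<gamma> x\<close> turns it into the sum
  of the squared coordinates over the fibre, and one coordinate is at most the norm.
\<close>

lemma mass_square_le_pairing:
  assumes L: "L \<in> combos" and x: "x \<in> space M"
  shows "(mass L x y)\<^sup>2 \<le> pairing L L x"
proof -
  define pt where "pt p = act (snd p) x" for p :: "real \<times> 'g"
  define \<D> where "\<D> = (\<lambda>p. E `` {pt p}) ` set L"
  \<comment> \<open>\<open>mass\<close> indexed by a class instead of a representative\<close>
  define mD where "mD K D = (\<Sum>p\<leftarrow>K. fst p * of_bool (pt p \<in> D))"
    for K :: "(real \<times> 'g) list" and D
  have fin: "finite \<D>" by (simp add: \<D>_def)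
  have pt: "pt p \<in> space M" if "p \<in> set L" for p
    using that L x by (auto simp: pt_def combos_def intro!: act_space)
  have mass_class: "mass K x z = mD K (E `` {z})" for K z
  proof -
    have "(pt p, z) \<in> E \<longleftrightarrow> pt p \<in> E `` {z}" for p
      using E_sym by blast
    then show ?thesis by (simp add: mass_def mD_def pt_def)
  qed
  have point: "mass L x (pt p) = (\<Sum>D\<in>\<D>. of_bool (pt p \<in> D) * mD L D)" if p: "p \<in> set L" for p
  proof -
    have "of_bool (pt p \<in> D) * mD L D = (if D = E `` {pt p} then mD L D else 0)" if D: "D \<in> \<D>" for D
    proof -
      obtain q where q: "q \<in> set L" "D = E `` {pt q}" using D unfolding \<D>_def by blast
      have "pt p \<in> D \<longleftrightarrow> D = E `` {pt p}"
        using eq_equiv_class_iff[OF equiv_E pt[OF q(1)] pt[OF p]] q by auto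
      then show ?thesis by simp
    qed
    then have "(\<Sum>D\<in>\<D>. of_bool (pt p \<in> D) * mD L D)
        = (\<Sum>D\<in>\<D>. if D = E `` {pt p} then mD L D else 0)"
      by (rule sum.cong[OF refl])
    also have "\<dots> = mD L (E `` {pt p})"
      using fin p by (simp add: \<D>_def)
    finally show ?thesis by (simp add: mass_class)
  qed
  have swap: "(\<Sum>p\<leftarrow>K. \<Sum>D\<in>\<D>. f p D) = (\<Sum>D\<in>\<D>. \<Sum>p\<leftarrow>K. f p D)"
    for K :: "(real \<times> 'g) list" and f :: "_ \<Rightarrow> _ \<Rightarrow> real"
    by (induction K) (simp_all add: sum.distrib)
  have "pairing L L x = (\<Sum>p\<leftarrow>L. \<Sum>D\<in>\<D>. fst p * of_bool (pt p \<in> D) * mD L D)"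
    unfolding pairing_def using point
    by (intro arg_cong[where f = sum_list] map_cong)
       (auto simp: pt_def sum_distrib_left mult.assoc)
  also have "\<dots> = (\<Sum>D\<in>\<D>. (mD L D)\<^sup>2)"
    unfolding swap by (simp add: sum_list_mult_const power2_eq_square mD_def)
  finally have squares: "pairing L L x = (\<Sum>D\<in>\<D>. (mD L D)\<^sup>2)" .
  show ?thesis
  proof (cases "E `` {y} \<in> \<D>")
    case True
    then have "(mD L (E `` {y}))\<^sup>2 \<le> (\<Sum>D\<in>\<D>. (mD L D)\<^sup>2)"
      using fin by (intro member_le_sum) auto
    then show ?thesis by (simp add: squares mass_class)
  next
    case False
    \<comment> \<open>a class that no \<open>\<gamma> x\<close> meets carries no mass\<close>
    have "(pt p, y) \<notin> E" if "p \<in> set L" for p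
      using False that equiv_class_eq[OF equiv_E] by (auto simp: \<D>_def)
    then have "mass L x y = (\<Sum>p\<leftarrow>L. 0)"
      unfolding mass_def by (intro arg_cong[where f = sum_list] map_cong) (auto simp: pt_def)
    then have "mass L x y = 0" by simp
    then show ?thesis by (simp add: squares sum_nonneg)
  qed
qed

lemma relation_event [measurable]:
  assumes "f \<in> measurable M M" "h \<in> measurable M M"
  shows "Measurable.pred M (\<lambda>x. (f x, h x) \<in> E)"
  using assms by measurable

lemma integrable_mass:
  assumes "L \<in> combos" "f \<in> measurable M M" "h \<in> measurable M M"
  shows "integrable M (\<lambda>x. mass L (f x) (h x))"
  using assms(1)
proof (induction L)
  case Nil
  then show ?case by (simp add: mass_def)
next
  case (Cons p L)
  have [measurable]: "act (snd p) \<in> measurable M M" "f \<in> measurable M M" "h \<in> measurable M M"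
    using Cons.prems assms by (auto simp: combos_def)
  have "integrable M (\<lambda>x. of_bool ((act (snd p) (f x), h x) \<in> E) :: real)"
    by (rule integrable_const_bound[where B = 1]) auto
  with Cons show ?case
    by (auto simp: mass_def combos_def)
qed

lemma integrable_pairing:
  assumes "L \<in> combos" "K \<in> combos"
  shows "integrable M (\<lambda>x. pairing L K x)"
  using assms(1)
proof (induction L)
  case Nil
  then show ?case by (simp add: pairing_def)
next
  case (Cons p L)
  then have "integrable M (\<lambda>x. mass K x (act (snd p) x))"
    by (intro integrable_mass[OF assms(2)]) (auto simp: combos_def)
  with Cons show ?case
    by (auto simp: pairing_def combos_def)
qed

lemma energy_nonneg:
  assumes "L \<in> combos"
  shows "0 \<le> energy L"
  unfolding energy_def
proof (rule integral_nonneg_AE, rule AE_I2)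
  fix x assume "x \<in> space M"
  from mass_square_le_pairing[OF assms this, of x] show "0 \<le> pairing L L x"
    by (rule order_trans[rotated]) simp
qed

text \<open>The group acts by isometries; this is where invariance of the measure enters.\<close>

lemma energy_shift:
  assumes "a \<in> carrier G" "L \<in> combos"
  shows "energy (shift a L) = energy L"
proof -
  have "energy (shift a L) = (\<integral>x. pairing L L (act a x) \<partial>M)"
    unfolding energy_def using assms by (intro Bochner_Integration.integral_cong) (auto simp: pairing_shift)
  also have "\<dots> = (\<integral>x. pairing L L x \<partial>distr M M (act a))"
    using assms integrable_pairing[of L L] by (intro integral_distr[symmetric]) auto
  finally show ?thesis by (simp add: distr_act assms energy_def)
qed

section \<open>The invariant element of least energy\<close>

lemma energy_parallelogram:
  assumes "L \<in> combos" "K \<in> combos"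
  shows "energy (L @ scale (-1) K) + 4 * energy (scale (1 / 2) (L @ K)) = 2 * energy L + 2 * energy K"
proof -
  define e where "e A B = (\<integral>x. pairing A B x \<partial>M)" for A B
  have int [simp]: "integrable M (pairing A B)" if "A \<in> {L, K}" "B \<in> {L, K}" for A B
    using that assms integrable_pairing[of A B] by auto
  have "pairing (L @ scale (-1) K) (L @ scale (-1) K) x
      = pairing L L x - pairing L K x - pairing K L x + pairing K K x" for x
    by (simp add: pairing_append pairing_scale)
  then have 1: "energy (L @ scale (-1) K) = e L L - e L K - e K L + e K K"
    by (simp add: energy_def e_def)
  have "pairing (scale (1 / 2) (L @ K)) (scale (1 / 2) (L @ K)) x
      = (1 / 4) * (pairing L L x + pairing L K x + pairing K L x + pairing K K x)" for x
    by (simp only: pairing_append pairing_scale) (simp add: field_simps)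
  then have 2: "energy (scale (1 / 2) (L @ K)) = (1 / 4) * (e L L + e L K + e K L + e K K)"
    unfolding energy_def e_def
    by (subst Bochner_Integration.integral_cong[OF refl,
          where g = "\<lambda>x. (1 / 4) * (pairing L L x + pairing L K x + pairing K L x + pairing K K x)"])
       (auto simp: fun_eq_iff)
  show ?thesis
    unfolding 1 2 by (simp add: energy_def e_def field_simps)
qed

definition min_energy :: real where
  "min_energy = Inf (energy ` averages)"

lemma averages_nonempty: "averages \<noteq> {}"
proof -
  have "[(1, \<one>)] \<in> averages" by (simp add: averages_def combos_def)
  then show ?thesis by blast
qed

lemma bdd_below_energy: "bdd_below (energy ` averages)"
  using energy_nonneg averages_combos by (intro bdd_belowI[of _ 0]) auto

text \<open>
  The midpoint of two averages is again an average, so its energy cannot drop below the infimum; the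
  parallelogram law then leaves little room for the difference.
\<close>

lemma near_minimisers_close:
  assumes "L \<in> averages" "K \<in> averages"
    and "energy L \<le> min_energy + \<eta>" "energy K \<le> min_energy + \<eta>"
  shows "energy (L @ scale (-1) K) \<le> 4 * \<eta>"
proof -
  have "min_energy \<le> energy (scale (1 / 2) (L @ K))"
    unfolding min_energy_def
    using averages_midpoint[OF assms(1,2)] bdd_below_energy by (intro cINF_lower)
  with energy_parallelogram[of L K] assms show ?thesis
    by (simp add: averages_combos)
qed

text \<open>
  This is used twice.  With \<open>b\<close> a minimising sequence and \<open>a\<close> its successor sequence, the differences
  telescope and give pointwise convergence; with \<open>a\<close> and \<open>b\<close> two translates of one minimising
  sequence, it gives invariance of the limit.
\<close>

lemma near_minimisers_AE_summable:
  assumes a: "\<And>n. a n \<in> averages" "\<And>n. energy (a n) \<le> min_energy + (1 / 4) ^ n"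
    and b: "\<And>n. b n \<in> averages" "\<And>n. energy (b n) \<le> min_energy + (1 / 4) ^ n"
    and g: "g \<in> carrier G"
  shows "AE x in M. summable (\<lambda>n. mass (a n) x (act g x) - mass (b n) x (act g x))"
proof -
  define D where "D n = a n @ scale (-1) (b n)" for n
  have D: "D n \<in> combos" for n
    using a b by (simp add: D_def combos_append combos_scale averages_combos)
  have mD: "mass (a n) x y - mass (b n) x y = mass (D n) x y" for n x y
    by (simp add: D_def mass_append mass_scale)
  have "AE x in M. summable (\<lambda>n. mass (D n) x (act g x))"
  proof (rule AE_summable_of_second_moments[where q = "\<lambda>n. pairing (D n) (D n)"])
    show "integrable M (\<lambda>x. mass (D n) x (act g x))" for n
      using D g by (intro integrable_mass) auto
    show "integrable M (pairing (D n) (D n))" for n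
      using integrable_pairing[OF D D] .
    show "(mass (D n) x (act g x))\<^sup>2 \<le> pairing (D n) (D n) x" if "x \<in> space M" for n x
      using D that by (rule mass_square_le_pairing)
    show "(\<integral>x. pairing (D n) (D n) x \<partial>M) \<le> 4 * (1 / 4) ^ n" for n
      using near_minimisers_close[OF a(1)[of n] b(1)[of n] a(2)[of n] b(2)[of n]]
      by (simp add: D_def energy_def)
  qed
  then show ?thesis by (simp add: mD)
qed

lemma minimising_sequence:
  "\<exists>c. \<forall>n. c n \<in> averages \<and> energy (c n) \<le> min_energy + (1 / 4) ^ n"
proof (rule choice, rule allI)
  fix n :: nat
  have ne: "energy ` averages \<noteq> {}" using averages_nonempty by simp
  have "Inf (energy ` averages) < min_energy + (1 / 4) ^ n"
    unfolding min_energy_def by simp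
  from cInf_lessD[OF ne this] obtain L
    where L: "L \<in> averages" "energy L < min_energy + (1 / 4) ^ n" by blast
  show "\<exists>L. L \<in> averages \<and> energy L \<le> min_energy + (1 / 4) ^ n"
    by (rule exI[of _ L]) (simp add: L less_imp_le)
qed

lemma mass_nonneg: "L \<in> averages \<Longrightarrow> 0 \<le> mass L x y"
  unfolding mass_def by (rule sum_list_nonneg) (auto simp: averages_def)

text \<open>
  Each \<open>\<gamma> x\<close> is equivalent to at most one of the pairwise inequivalent points of \<open>Y\<close>, so it contributes
  its weight at most once.
\<close>

lemma sum_mass_le_one:
  assumes L: "L \<in> averages" and Y: "finite Y" "pairwise (\<lambda>y z. (y, z) \<notin> E) Y"
  shows "(\<Sum>y\<in>Y. mass L x y) \<le> 1"
proof -
  have one: "(\<Sum>y\<in>Y. of_bool ((w, y) \<in> E) :: real) \<le> 1" for w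
  proof -
    have "y = z" if "y \<in> Y" "z \<in> Y" "(w, y) \<in> E" "(w, z) \<in> E" for y z
      using that Y(2) E_sym E_trans unfolding pairwise_def by blast
    then have "card {y \<in> Y. (w, y) \<in> E} \<le> 1"
      using Y(1) by (auto simp: card_le_Suc0_iff_eq)
    moreover have "(\<Sum>y\<in>Y. of_bool ((w, y) \<in> E) :: real) = real (card {y \<in> Y. (w, y) \<in> E})"
      using Y(1) by (simp add: of_bool_def sum.If_cases Int_def)
    ultimately show ?thesis by simp
  qed
  have "(\<Sum>y\<in>Y. mass L x y) = (\<Sum>p\<leftarrow>L. fst p * (\<Sum>y\<in>Y. of_bool ((act (snd p) x, y) \<in> E)))"
    unfolding mass_def sum_distrib_left by (induction L) (simp_all add: sum.distrib)
  also have "\<dots> \<le> (\<Sum>p\<leftarrow>L. fst p)"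
    using L one by (intro sum_list_mono) (auto simp: averages_def intro!: mult_left_le)
  finally show ?thesis using L by (simp add: averages_def)
qed

lemma mass_le_one: "L \<in> averages \<Longrightarrow> mass L x y \<le> 1"
  using sum_mass_le_one[of L "{y}" x] by simp

lemma integral_mass_diagonal_ge:
  assumes b: "\<forall>h\<in>carrier G. b \<le> phi M E (act h)" and L: "L \<in> averages"
  shows "b \<le> (\<integral>x. mass L x x \<partial>M)"
proof -
  have "(\<integral>x. mass L x x \<partial>M) = (\<Sum>p\<leftarrow>L. fst p * phi M E (act (snd p)))" if "L \<in> combos" for L
    using that
  proof (induction L)
    case Nil
    then show ?case by (simp add: mass_def)
  next
    case (Cons p L)
    have L: "L \<in> combos" and [measurable]: "act (snd p) \<in> measurable M M"
      using Cons.prems by (auto simp: combos_def)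
    have 1: "integrable M (\<lambda>x. of_bool ((act (snd p) x, x) \<in> E) :: real)"
      by (rule integrable_const_bound[where B = 1]) auto
    have 2: "(\<integral>x. of_bool ((act (snd p) x, x) \<in> E) \<partial>M) = phi M E (act (snd p))"
    proof -
      have "(\<integral>x. of_bool ((act (snd p) x, x) \<in> E) \<partial>M)
          = (\<integral>x. indicator {x \<in> space M. (act (snd p) x, x) \<in> E} x \<partial>M :: real)"
        by (intro Bochner_Integration.integral_cong) (auto simp: indicator_def)
      then show ?thesis by (simp add: phi_def)
    qed
    have "mass (p # L) x x = fst p * of_bool ((act (snd p) x, x) \<in> E) + mass L x x" for x
      by (simp add: mass_def)
    then show ?case
      using 1 2 Cons.IH[OF L] integrable_mass[OF L, of "\<lambda>x. x" "\<lambda>x. x"] by simp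
  qed
  then have "(\<integral>x. mass L x x \<partial>M) = (\<Sum>p\<leftarrow>L. fst p * phi M E (act (snd p)))"
    using L averages_combos by blast
  also have "\<dots> \<ge> (\<Sum>p\<leftarrow>L. fst p * b)"
    using L b by (intro sum_list_mono mult_left_mono) (auto simp: averages_def combos_def)
  finally show ?thesis using L by (simp add: averages_def sum_list_mult_const)
qed

text \<open>
  The function \<open>g\<close> is the value of the least-norm vector at \<open>(x, [x]\<^sub>E)\<close>.  The conull set \<open>Z\<close> is exactly
  invariant under the group, so that on \<open>Z\<close> the assertions about orbits hold at every point and the
  sets built from \<open>g\<close> later need no further corrections on null sets.
\<close>

theorem class_density:
  assumes b: "\<forall>h\<in>carrier G. b \<le> phi M E (act h)"
  shows "\<exists>g Z. g \<in> borel_measurable M \<and> (\<forall>x. 0 \<le> g x \<and> g x \<le> 1) \<and> b \<le> (\<integral>x. g x \<partial>M) \<and>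
    Z \<in> sets M \<and> (AE x in M. x \<in> Z) \<and> (\<forall>x\<in>Z. \<forall>a\<in>carrier G. act a x \<in> Z) \<and>
    (\<forall>x\<in>Z. \<forall>y\<in>orbit G act x. \<forall>z\<in>orbit G act x. (y, z) \<in> E \<longrightarrow> g y = g z) \<and>
    (\<forall>x\<in>Z. \<forall>Y\<subseteq>orbit G act x. finite Y \<longrightarrow> pairwise (\<lambda>y z. (y, z) \<notin> E) Y \<longrightarrow> (\<Sum>y\<in>Y. g y) \<le> 1)"
proof -
  obtain c where c: "\<And>n. c n \<in> averages" "\<And>n. energy (c n) \<le> min_energy + (1 / 4) ^ n"
    using minimising_sequence by blast
  \<comment> \<open>If \<open>d\<close> tends to 0, the coordinate at the class of \<open>\<beta> x\<close> is asymptotically the same over the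
    fibres of \<open>\<alpha> x\<close> and of \<open>\<beta> x\<close>.  Quantifying over \<open>\<alpha>\<close> and \<open>\<beta>\<close> makes \<open>Z\<close> invariant.\<close>
  define d where "d \<alpha> \<beta> x n = mass (c n) (act \<alpha> x) (act \<beta> x) - mass (c n) (act \<beta> x) (act \<beta> x)"
    for \<alpha> \<beta> x n
  define good where "good \<alpha> \<beta> x \<longleftrightarrow>
      convergent (\<lambda>n. mass (c n) (act \<alpha> x) (act \<alpha> x)) \<and> convergent (d \<alpha> \<beta> x) \<and> lim (d \<alpha> \<beta> x) = 0"
    for \<alpha> \<beta> x
  define Z where "Z = {x \<in> space M. \<forall>\<alpha>\<in>carrier G. \<forall>\<beta>\<in>carrier G. good \<alpha> \<beta> x}"
  define g where "g x = (if x \<in> Z then lim (\<lambda>n. mass (c n) x x) else 0)" for x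

  have mass_meas: "(\<lambda>x. mass (c n) (f x) (h x)) \<in> borel_measurable M"
    if "f \<in> measurable M M" "h \<in> measurable M M" for n f h
    using integrable_mass[OF averages_combos[OF c(1)] that] by simp
  have good_meas: "Measurable.pred M (good \<alpha> \<beta>)" if "\<alpha> \<in> carrier G" "\<beta> \<in> carrier G" for \<alpha> \<beta>
  proof -
    have [measurable]: "(\<lambda>x. mass (c n) (act \<alpha> x) (act \<alpha> x)) \<in> borel_measurable M"
      "(\<lambda>x. mass (c n) (act \<alpha> x) (act \<beta> x)) \<in> borel_measurable M"
      "(\<lambda>x. mass (c n) (act \<beta> x) (act \<beta> x)) \<in> borel_measurable M" for n
      using that by (auto intro: mass_meas)
    show ?thesis unfolding good_def[abs_def] d_def
      by (intro pred_intros_logic pred_convergent_real) measurable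
  qed
  have Z: "Z \<in> sets M"
  proof -
    have "Measurable.pred M (\<lambda>x. \<forall>\<alpha>\<in>carrier G. \<forall>\<beta>\<in>carrier G. good \<alpha> \<beta> x)"
      using good_meas by (intro measurable_pred_countable countable_carrier)
    then show ?thesis by (simp add: Z_def pred_def)
  qed
  have diag_meas [measurable]: "(\<lambda>x. mass (c n) x x) \<in> borel_measurable M" for n
    using mass_meas[of "\<lambda>x. x" "\<lambda>x. x"] by simp
  have g_meas: "g \<in> borel_measurable M"
    unfolding g_def[abs_def] using Z by measurable

  have "AE x in M. good \<alpha> \<beta> x" if \<alpha>: "\<alpha> \<in> carrier G" and \<beta>: "\<beta> \<in> carrier G" for \<alpha> \<beta>
  proof -
    have s: "shift a (c n) \<in> averages" "energy (shift a (c n)) \<le> min_energy + (1 / 4) ^ n"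
      if "a \<in> carrier G" for a n
      using c that by (auto simp: averages_shift energy_shift averages_combos)
    have s': "energy (shift \<alpha> (c (Suc n))) \<le> min_energy + (1 / 4) ^ n" for n
    proof -
      have "(1 / 4 :: real) ^ Suc n \<le> (1 / 4) ^ n" by simp
      with s(2)[OF \<alpha>, of "Suc n"] show ?thesis by linarith
    qed
    have "AE x in M. summable (\<lambda>n. mass (shift \<alpha> (c (Suc n))) x (act \<alpha> x) - mass (shift \<alpha> (c n)) x (act \<alpha> x))"
      by (rule near_minimisers_AE_summable[where a = "\<lambda>n. shift \<alpha> (c (Suc n))"
            and b = "\<lambda>n. shift \<alpha> (c n)", OF s(1)[OF \<alpha>] s' s[OF \<alpha>] \<alpha>])
    moreover have "AE x in M. summable (\<lambda>n. mass (shift \<alpha> (c n)) x (act \<beta> x) - mass (shift \<beta> (c n)) x (act \<beta> x))"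
      by (rule near_minimisers_AE_summable[where a = "\<lambda>n. shift \<alpha> (c n)"
            and b = "\<lambda>n. shift \<beta> (c n)", OF s[OF \<alpha>] s[OF \<beta>] \<beta>])
    ultimately show ?thesis
      using AE_space
    proof eventually_elim
      case (elim x)
      define f where "f n = mass (c n) (act \<alpha> x) (act \<alpha> x)" for n
      have "summable (\<lambda>n. f (Suc n) - f n)"
        using elim \<alpha> c(1) by (simp add: f_def mass_shift averages_combos)
      then have "convergent (\<lambda>n. f n - f 0)"
        by (simp add: summable_iff_convergent sum_lessThan_telescope)
      then have "convergent f"
        by (simp add: convergent_diff_const_right_iff)
      moreover have "summable (d \<alpha> \<beta> x)"
        using elim \<alpha> \<beta> c(1) by (simp add: d_def[abs_def] mass_shift averages_combos)
      then have "d \<alpha> \<beta> x \<longlonglongrightarrow> 0" by (rule summable_LIMSEQ_zero)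
      ultimately show ?case
        by (auto simp: good_def f_def[abs_def] convergent_def limI)
    qed
  qed
  then have AE_Z: "AE x in M. x \<in> Z"
    unfolding Z_def using countable_carrier by (simp add: AE_ball_countable)

  have Z_act: "act a x \<in> Z" if x: "x \<in> Z" and a: "a \<in> carrier G" for x a
  proof -
    have "act \<alpha> (act a x) = act (\<alpha> \<otimes> a) x" if "\<alpha> \<in> carrier G" for \<alpha>
      using x a that by (intro composition_rule[symmetric]) (auto simp: Z_def)
    then have "good \<alpha> \<beta> (act a x) \<longleftrightarrow> good (\<alpha> \<otimes> a) (\<beta> \<otimes> a) x"
      if "\<alpha> \<in> carrier G" "\<beta> \<in> carrier G" for \<alpha> \<beta>
      using that by (simp add: good_def d_def[abs_def])
    then show ?thesis
      using x a by (auto simp: Z_def act_space)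
  qed
  have diag: "(\<lambda>n. mass (c n) x x) \<longlonglongrightarrow> g x" if x: "x \<in> Z" for x
  proof -
    have "good \<one> \<one> x" "x \<in> space M" using x by (auto simp: Z_def)
    then show ?thesis using x by (simp add: good_def act_one g_def convergent_LIMSEQ_iff)
  qed
  have conv: "(\<lambda>n. mass (c n) x y) \<longlonglongrightarrow> g y" if x: "x \<in> Z" and y: "y \<in> orbit G act x" for x y
  proof -
    obtain \<beta> where \<beta>: "\<beta> \<in> carrier G" "y = act \<beta> x" using y by (auto simp: orbit_def)
    have "good \<one> \<beta> x" "x \<in> space M" using x \<beta> by (auto simp: Z_def)
    then have "(\<lambda>n. mass (c n) x y - mass (c n) y y) \<longlonglongrightarrow> 0"
      using \<beta> by (auto simp: good_def d_def[abs_def] act_one convergent_LIMSEQ_iff)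
    moreover have "(\<lambda>n. mass (c n) y y) \<longlonglongrightarrow> g y"
      using Z_act[OF x] \<beta> by (intro diag) simp
    ultimately show ?thesis by (rule Lim_transform[rotated])
  qed
  have g01: "0 \<le> g x \<and> g x \<le> 1" for x
  proof (cases "x \<in> Z")
    case True
    from LIMSEQ_le_const[OF diag[OF this], of 0] LIMSEQ_le_const2[OF diag[OF this], of 1]
    show ?thesis using mass_nonneg[OF c(1)] mass_le_one[OF c(1)] by simp
  qed (simp add: g_def)
  have "(\<lambda>n. \<integral>x. mass (c n) x x \<partial>M) \<longlonglongrightarrow> (\<integral>x. g x \<partial>M)"
  proof (rule integral_dominated_convergence[where w = "\<lambda>_. 1"])
    show "AE x in M. (\<lambda>n. mass (c n) x x) \<longlonglongrightarrow> g x"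
      using AE_Z by eventually_elim (rule diag)
    show "AE x in M. norm (mass (c n) x x) \<le> 1" for n
      using mass_nonneg[OF c(1)[of n]] mass_le_one[OF c(1)[of n]] by simp
  qed (use g_meas in auto)
  then have int: "b \<le> (\<integral>x. g x \<partial>M)"
    by (rule LIMSEQ_le_const) (use integral_mass_diagonal_ge[OF b] c(1) in auto)
  have inv: "g y = g z"
    if "x \<in> Z" "y \<in> orbit G act x" "z \<in> orbit G act x" "(y, z) \<in> E" for x y z
  proof -
    have "(\<lambda>n. mass (c n) x y) \<longlonglongrightarrow> g z"
      using conv[OF that(1,3)] by (simp add: mass_cong[OF that(4)])
    with conv[OF that(1,2)] show ?thesis by (rule LIMSEQ_unique)
  qed
  have sum: "(\<Sum>y\<in>Y. g y) \<le> 1"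
    if "x \<in> Z" "Y \<subseteq> orbit G act x" "finite Y" "pairwise (\<lambda>y z. (y, z) \<notin> E) Y" for x Y
  proof (rule LIMSEQ_le_const2)
    show "(\<lambda>n. \<Sum>y\<in>Y. mass (c n) x y) \<longlonglongrightarrow> (\<Sum>y\<in>Y. g y)"
      using conv that by (intro tendsto_sum) auto
    show "\<exists>N. \<forall>n\<ge>N. (\<Sum>y\<in>Y. mass (c n) x y) \<le> 1"
      using sum_mass_le_one[OF c(1)] that by auto
  qed
  show ?thesis
    by (rule exI[of _ g], rule exI[of _ Z])
       (intro conjI allI ballI impI g_meas int Z AE_Z Z_act inv sum; (assumption | simp add: g01))
qed

section \<open>Orbits with finitely many heavy classes, and the full group\<close>

lemma orbit_eqI:
  assumes "x \<in> space M" "y \<in> orbit G act x"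
  shows "orbit G act y = orbit G act x"
proof -
  have y: "y \<in> space M" using assms by (auto simp: orbit_def intro: act_space)
  have sub: "orbit G act b \<subseteq> orbit G act a" if "a \<in> space M" "b \<in> space M" "b \<in> orbit G act a" for a b
  proof
    fix c assume c: "c \<in> orbit G act b"
    then have "c \<in> space M" using that by (auto simp: orbit_def intro: act_space)
    with c that show "c \<in> orbit G act a" using orbit_trans by blast
  qed
  from sub[OF assms(1) y assms(2)] sub[OF y assms(1) orbit_sym[OF assms(1) y assms(2)]]
  show ?thesis by blast
qed

lemma orbit_space: "x \<in> space M \<Longrightarrow> y \<in> orbit G act x \<Longrightarrow> y \<in> space M"
  by (auto simp: orbit_def intro: act_space)

lemma orbit_equiv_iff: "(x, y) \<in> orbit_equiv G M act \<longleftrightarrow> x \<in> space M \<and> y \<in> orbit G act x"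
  by (simp add: orbit_equiv_def)

text \<open>
  The number of \<open>E\<close>-classes of \<open>B = {g \<ge> b}\<close> in an orbit is bounded by \<open>1 / b\<close>, so there is a largest
  \<open>m\<close> for which the set of points of \<open>B\<close> with at least \<open>m\<close> such classes in their orbit is not null.
  Removing the null set of points with at least \<open>m + 1\<close> classes leaves exactly \<open>m\<close>.
\<close>

theorem finite_index_piece:
  assumes sub: "E \<subseteq> orbit_equiv G M act"
    and b: "\<forall>h\<in>carrier G. b \<le> phi M E (act h)" and b_pos: "0 < b"
  obtains A m where "A \<in> sets M" "0 < measure M A" "E `` A \<subseteq> A"
    "has_index A (Restr (orbit_equiv G M act) A) (Restr E A) m" "real m \<le> 1 / b"
proof -
  from class_density[OF b] obtain g Z where
    g: "g \<in> borel_measurable M" "b \<le> (\<integral>x. g x \<partial>M)" and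
    g01: "\<forall>x. 0 \<le> g x \<and> g x \<le> 1" and
    Z: "Z \<in> sets M" "AE x in M. x \<in> Z" and Z_act: "\<forall>x\<in>Z. \<forall>a\<in>carrier G. act a x \<in> Z" and
    g_inv: "\<forall>x\<in>Z. \<forall>y\<in>orbit G act x. \<forall>z\<in>orbit G act x. (y, z) \<in> E \<longrightarrow> g y = g z" and
    g_sum: "\<forall>x\<in>Z. \<forall>Y\<subseteq>orbit G act x. finite Y \<longrightarrow> pairwise (\<lambda>y z. (y, z) \<notin> E) Y \<longrightarrow>
      (\<Sum>y\<in>Y. g y) \<le> 1"
    by (elim exE conjE)
  note [measurable] = g(1) Z(1)
  have Z_space: "x \<in> space M" if "x \<in> Z" for x
    using that sets.sets_into_space[OF Z(1)] by blast
  define B where "B = {x \<in> space M. x \<in> Z \<and> b \<le> g x}"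
  have B [measurable]: "B \<in> sets M" unfolding B_def by measurable
  have B_D: "x \<in> Z" "x \<in> space M" "b \<le> g x" if "x \<in> B" for x
    using that by (auto simp: B_def)
  have E_orbit: "x \<in> space M" "y \<in> space M" "y \<in> orbit G act x" if "(x, y) \<in> E" for x y
    using that sub orbit_space by (auto simp: orbit_equiv_iff dest!: subsetD)
  have B_inv: "y \<in> B" if xy: "(x, y) \<in> E" and x: "x \<in> B" for x y
  proof -
    have "y \<in> Z" using E_orbit(3)[OF xy] B_D(1)[OF x] Z_act by (auto simp: orbit_def)
    moreover have "g x = g y"
      using xy E_orbit[OF xy] B_D[OF x] orbit_refl by (intro g_inv[rule_format, of x]) auto
    ultimately show ?thesis using B_D[OF x] Z_space by (simp add: B_def)
  qed

  \<comment> \<open>\<open>sep k x\<close>: the orbit of \<open>x\<close> contains at least \<open>k\<close> classes of \<open>B\<close>\<close>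
  define sep where "sep k x \<longleftrightarrow> (\<exists>Y. finite Y \<and> card Y = k \<and> Y \<subseteq> orbit G act x \<inter> B \<and>
      pairwise (\<lambda>y z. (y, z) \<notin> E) Y)" for k x
  define P where "P k = {x \<in> space M. x \<in> B \<and> sep k x}" for k
  \<comment> \<open>witnesses indexed by finite subsets of the countable group make this condition measurable\<close>
  have sep_iff: "sep k x \<longleftrightarrow> (\<exists>S\<in>{S. finite S \<and> S \<subseteq> carrier G}. card S = k \<and>
      (\<forall>s\<in>S. act s x \<in> B) \<and> (\<forall>s\<in>S. \<forall>t\<in>S. s \<noteq> t \<longrightarrow> (act s x, act t x) \<notin> E))" (is "_ \<longleftrightarrow> ?R")
    for k x
  proof
    assume "sep k x"
    then obtain Y where Y: "finite Y" "card Y = k" "Y \<subseteq> orbit G act x \<inter> B"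
      "pairwise (\<lambda>y z. (y, z) \<notin> E) Y" unfolding sep_def by blast
    have "Y \<subseteq> (\<lambda>s. act s x) ` carrier G" using Y(3) by (auto simp: orbit_def)
    then obtain S where S: "S \<subseteq> carrier G" "inj_on (\<lambda>s. act s x) S" "Y = (\<lambda>s. act s x) ` S"
      unfolding subset_image_inj by (elim exE conjE)
    have "finite S"
      using finite_imageD[OF _ S(2)] Y(1) by (simp add: S(3))
    moreover have "card S = k"
      using card_image[OF S(2)] Y(2) by (simp add: S(3))
    moreover have "\<forall>s\<in>S. \<forall>t\<in>S. s \<noteq> t \<longrightarrow> (act s x, act t x) \<notin> E"
      using Y(4) inj_onD[OF S(2)] by (force simp: S(3) pairwise_def)
    moreover have "\<forall>s\<in>S. act s x \<in> B"
      using Y(3) by (auto simp: S(3))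
    ultimately show ?R using S(1) by (intro bexI[of _ S]) simp_all
  next
    assume ?R
    then obtain S where S: "finite S" "S \<subseteq> carrier G" "card S = k" "\<forall>s\<in>S. act s x \<in> B"
      "\<forall>s\<in>S. \<forall>t\<in>S. s \<noteq> t \<longrightarrow> (act s x, act t x) \<notin> E" by auto
    have "inj_on (\<lambda>s. act s x) S"
    proof (rule inj_onI)
      fix s t assume st: "s \<in> S" "t \<in> S" "act s x = act t x"
      then have "(act s x, act t x) \<in> E" using S(4) B_D(2) E_refl by simp
      with st S(5) show "s = t" by blast
    qed
    then have "card ((\<lambda>s. act s x) ` S) = k" using S(3) by (simp add: card_image)
    moreover have "pairwise (\<lambda>y z. (y, z) \<notin> E) ((\<lambda>s. act s x) ` S)"
      using S(5) by (force simp: pairwise_def)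
    moreover have "(\<lambda>s. act s x) ` S \<subseteq> orbit G act x \<inter> B"
      using S(2,4) by (auto simp: orbit_def)
    ultimately show "sep k x"
      unfolding sep_def using S(1) by (intro exI[of _ "(\<lambda>s. act s x) ` S"]) simp
  qed
  have P_sets: "P k \<in> sets M" for k
  proof -
    have "Measurable.pred M (sep k)"
      unfolding sep_iff[abs_def]
    proof (rule measurable_pred_countable(2)[OF countable_Collect_finite_subset[OF countable_carrier]])
      fix S assume "S \<in> {S. finite S \<and> S \<subseteq> carrier G}"
      then have S: "countable S" and S_act [measurable]: "\<And>s. s \<in> S \<Longrightarrow> act s \<in> measurable M M"
        by (auto intro: countable_finite)
      show "Measurable.pred M (\<lambda>x. card S = k \<and> (\<forall>s\<in>S. act s x \<in> B) \<and>
          (\<forall>s\<in>S. \<forall>t\<in>S. s \<noteq> t \<longrightarrow> (act s x, act t x) \<notin> E))"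
      proof (intro pred_intros_logic measurable_pred_countable[OF S])
        show "Measurable.pred M (\<lambda>x. act s x \<in> B)" if "s \<in> S" for s
          using S_act[OF that] by measurable
        show "Measurable.pred M (\<lambda>x. (act s x, act t x) \<in> E)" if "s \<in> S" "t \<in> S" for s t
          using S_act that by (intro relation_event) auto
      qed auto
    qed
    then show ?thesis unfolding P_def by measurable
  qed
  have P_bound: "real k * b \<le> 1" if x: "x \<in> P k" for k x
  proof -
    from x obtain Y where Y: "finite Y" "card Y = k" "Y \<subseteq> orbit G act x \<inter> B"
      "pairwise (\<lambda>y z. (y, z) \<notin> E) Y" unfolding P_def sep_def by blast
    have "real k * b = (\<Sum>y\<in>Y. b)" using Y by simp
    also have "\<dots> \<le> (\<Sum>y\<in>Y. g y)" using Y B_D(3) by (intro sum_mono) blast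
    also have "\<dots> \<le> 1" using x Y by (intro g_sum[rule_format, of x]) (auto simp: P_def B_def)
    finally show ?thesis .
  qed
  have B_pos: "0 < measure M B"
  proof (rule ccontr)
    assume "\<not> 0 < measure M B"
    then have "emeasure M B = 0"
      by (simp add: emeasure_eq_measure not_less measure_le_0_iff)
    then have "AE x in M. x \<notin> B" using B by (intro AE_not_in) (simp add: null_sets_def)
    with Z(2) have "AE x in M. g x < b"
      using AE_space by eventually_elim (auto simp: B_def)
    moreover have "integrable M g"
      using g g01 by (intro integrable_const_bound[where B = 1]) auto
    ultimately have "(\<integral>x. g x \<partial>M) < (\<integral>x. b \<partial>M)"
      by (intro integral_less_AE_space) (auto simp: emeasure_space_1)
    with g(2) show False by (simp add: prob_space)
  qed
  have "P 1 = B"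
  proof -
    have "sep 1 x" if "x \<in> B" for x
      unfolding sep_def using that orbit_refl B_D by (intro exI[of _ "{x}"]) auto
    then show ?thesis using B_D by (auto simp: P_def)
  qed
  define K where "K = {k. 0 < measure M (P k)}"
  have K_le: "real k \<le> 1 / b" if "k \<in> K" for k
  proof -
    have "P k \<noteq> {}" using that by (auto simp: K_def)
    then show ?thesis using P_bound b_pos by (fastforce simp: field_simps)
  qed
  have "finite K"
  proof (rule finite_subset)
    show "K \<subseteq> {..nat \<lfloor>1 / b\<rfloor>}" using K_le by (auto simp: le_nat_floor)
  qed simp
  have "1 \<in> K" using B_pos \<open>P 1 = B\<close> by (simp add: K_def)
  define m where "m = Max K"
  have m: "m \<in> K" unfolding m_def using \<open>finite K\<close> \<open>1 \<in> K\<close> by (intro Max_in) auto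
  have "m + 1 \<notin> K" using Max_ge[OF \<open>finite K\<close>, of "m + 1"] by (auto simp: m_def)
  then have null: "measure M (P (m + 1)) = 0"
    by (simp add: K_def not_less measure_le_0_iff)

  define A where "A = P m - P (m + 1)"
  have A_iff: "x \<in> A \<longleftrightarrow> x \<in> B \<and> sep m x \<and> \<not> sep (m + 1) x" for x
    using B_D by (auto simp: A_def P_def)
  have A_orbit: "y \<in> A" if "x \<in> A" "y \<in> orbit G act x" "y \<in> B" for x y
    using that B_D orbit_eqI[of x y] by (auto simp: A_iff sep_def)
  have A_E: "y \<in> A" if "x \<in> A" "(x, y) \<in> E" for x y
    using that A_orbit E_orbit B_inv A_iff by blast
  show ?thesis
  proof (rule that)
    show "A \<in> sets M" using P_sets by (simp add: A_def)
    have "measure M (P m) \<le> measure M (A \<union> P (m + 1))"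
      using P_sets by (intro finite_measure_mono) (auto simp: A_def)
    also have "\<dots> \<le> measure M A + measure M (P (m + 1))"
      using P_sets \<open>A \<in> sets M\<close> by (intro measure_Un_le) auto
    finally show "0 < measure M A" using m null by (simp add: K_def)
    show "E `` A \<subseteq> A" using A_E by blast
    show "real m \<le> 1 / b" using K_le m by blast
    show "has_index A (Restr (orbit_equiv G M act) A) (Restr E A) m"
      unfolding has_index_def
    proof
      fix C assume "C \<in> A // Restr (orbit_equiv G M act) A"
      then obtain x where x: "x \<in> A" "C = Restr (orbit_equiv G M act) A `` {x}"
        by (auto elim: quotientE)
      have x': "x \<in> space M" using x(1) B_D by (simp add: A_iff)
      have C: "z \<in> C \<longleftrightarrow> z \<in> A \<and> z \<in> orbit G act x" for z
        using x x' by (auto simp: orbit_equiv_iff)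
      obtain Y where Y: "finite Y" "card Y = m" "Y \<subseteq> orbit G act x \<inter> B"
        "pairwise (\<lambda>y z. (y, z) \<notin> E) Y" using x by (auto simp: A_iff sep_def)
      define cl where "cl y = Restr E A `` {y}" for y
      have cl: "z \<in> cl y \<longleftrightarrow> (y, z) \<in> E \<and> y \<in> A \<and> z \<in> A" for y z
        by (auto simp: cl_def)
      have cl_self: "y \<in> cl y" if "y \<in> A" for y
        using that E_refl B_D by (simp add: cl A_iff)
      have Y_A: "y \<in> A" if "y \<in> Y" for y
        using A_orbit[OF x(1)] that Y(3) by blast
      have "{D \<in> A // Restr E A. D \<subseteq> C} = cl ` Y"
      proof
        show "cl ` Y \<subseteq> {D \<in> A // Restr E A. D \<subseteq> C}"
        proof (clarsimp, intro conjI subsetI)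
          fix y assume y: "y \<in> Y"
          show "cl y \<in> A // Restr E A" unfolding cl_def using Y_A[OF y] by (rule quotientI)
          fix z assume z: "z \<in> cl y"
          have "z \<in> orbit G act y" using z E_orbit(3) by (simp add: cl)
          also have "orbit G act y = orbit G act x" using Y(3) y x' by (intro orbit_eqI) auto
          finally show "z \<in> C" using z by (simp add: C cl)
        qed
        show "{D \<in> A // Restr E A. D \<subseteq> C} \<subseteq> cl ` Y"
        proof
          fix D assume D: "D \<in> {D \<in> A // Restr E A. D \<subseteq> C}"
          then obtain z where z: "z \<in> A" "D = cl z"
            unfolding cl_def by (auto elim: quotientE)
          have zx: "z \<in> orbit G act x" using D z cl_self C by blast
          have "\<exists>y\<in>Y. (y, z) \<in> E"
          \<comment> \<open>otherwise \<open>z\<close> would represent one more class of \<open>B\<close> in the orbit\<close>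
          proof (rule ccontr)
            assume no: "\<not> (\<exists>y\<in>Y. (y, z) \<in> E)"
            then have "z \<notin> Y" using E_refl z B_D by (auto simp: A_iff)
            moreover have "pairwise (\<lambda>y z. (y, z) \<notin> E) (insert z Y)"
              using no Y(4) E_sym by (auto simp: pairwise_insert)
            ultimately have "sep (m + 1) x"
              unfolding sep_def using Y zx z by (intro exI[of _ "insert z Y"]) (auto simp: A_iff)
            then show False using x by (simp add: A_iff)
          qed
          then obtain y where y: "y \<in> Y" "(y, z) \<in> E" ..
          have "(z, w) \<in> E \<longleftrightarrow> (y, w) \<in> E" for w
            using y(2) E_sym E_trans by blast
          then have "cl z = cl y"
            using z(1) Y_A[OF y(1)] by (intro Set.set_eqI) (simp add: cl)
          with y z show "D \<in> cl ` Y" by blast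
        qed
      qed
      moreover have "inj_on cl Y"
      proof (rule inj_onI)
        fix y y' assume "y \<in> Y" "y' \<in> Y" "cl y = cl y'"
        then have "(y, y') \<in> E" using cl_self[OF Y_A, of y'] cl by blast
        with \<open>y \<in> Y\<close> \<open>y' \<in> Y\<close> Y(4) show "y = y'" by (auto simp: pairwise_def)
      qed
      ultimately show "finite {D \<in> A // Restr E A. D \<subseteq> C} \<and> card {D \<in> A // Restr E A. D \<subseteq> C} = m"
        using Y by (simp add: card_image)
    qed
  qed
qed

text \<open>
  Where \<open>S\<close> leaves the \<open>E\<close>-class, the two classes of \<open>x\<close> and \<open>S x\<close> share a total density of at most 1.
\<close>

theorem full_group_phi_ge:
  assumes b: "\<forall>h\<in>carrier G. 1 - \<epsilon> \<le> phi M E (act h)"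
    and S: "S \<in> full_group M (orbit_equiv G M act)"
  shows "1 - 2 * \<epsilon> \<le> phi M E S"
proof -
  from class_density[OF b] obtain g Z where
    g: "g \<in> borel_measurable M" "1 - \<epsilon> \<le> (\<integral>x. g x \<partial>M)" and
    g01: "\<forall>x. 0 \<le> g x \<and> g x \<le> 1" and Z: "AE x in M. x \<in> Z" and
    g_sum: "\<forall>x\<in>Z. \<forall>Y\<subseteq>orbit G act x. finite Y \<longrightarrow> pairwise (\<lambda>y z. (y, z) \<notin> E) Y \<longrightarrow>
      (\<Sum>y\<in>Y. g y) \<le> 1"
    by (elim exE conjE)
  have S_meas [measurable]: "S \<in> measurable M M" and S_distr: "distr M M S = M"
    and S_orbit: "AE x in M. (S x, x) \<in> orbit_equiv G M act"
    using S by (auto simp: full_group_def Aut_def measure_iso_def borel_iso_def)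
  have int_g: "integrable M g"
    using g g01 by (intro integrable_const_bound[where B = 1]) auto
  have int_gS: "integrable M (\<lambda>x. g (S x))"
    using g g01 by (intro integrable_const_bound[where B = 1]) auto
  have gS: "(\<integral>x. g (S x) \<partial>M) = (\<integral>x. g x \<partial>M)"
    using integral_distr[OF S_meas g(1)] by (simp add: S_distr)
  define R where "R = {x \<in> space M. (S x, x) \<in> E}"
  have R: "R \<in> sets M" unfolding R_def by measurable
  have "(\<integral>x. g (S x) + g x \<partial>M) \<le> (\<integral>x. 1 + indicator R x \<partial>M)"
  proof (rule integral_mono_AE)
    show "AE x in M. g (S x) + g x \<le> 1 + indicator R x"
      using Z S_orbit AE_space
    proof eventually_elim
      case (elim x)
      then have "S x \<in> space M" "x \<in> orbit G act (S x)" by (auto simp: orbit_equiv_iff)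
      then have Sx: "S x \<in> orbit G act x" and xx: "x \<in> orbit G act x"
        using elim orbit_sym orbit_refl by auto
      show ?case
      proof (cases "(S x, x) \<in> E")
        case True
        then show ?thesis using elim g01[rule_format, of x] g01[rule_format, of "S x"] by (simp add: R_def)
      next
        case False
        then have "(x, S x) \<notin> E" "S x \<noteq> x" using E_sym E_refl elim by auto
        then have "(\<Sum>y\<in>{S x, x}. g y) \<le> 1"
          using False Sx xx elim by (intro g_sum[rule_format, of x]) (auto simp: pairwise_insert)
        then show ?thesis using \<open>S x \<noteq> x\<close> by (simp add: indicator_def)
      qed
    qed
    show "integrable M (\<lambda>x. 1 + indicator R x :: real)"
      using R by (intro Bochner_Integration.integrable_add integrable_real_indicator)
        (auto simp: emeasure_eq_measure)
  qed (use int_g int_gS in auto)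
  also have "\<dots> = 1 + phi M E S"
  proof -
    have "(\<integral>x. 1 + indicator R x \<partial>M) = (\<integral>x. 1 \<partial>M) + (\<integral>x. indicator R x \<partial>M :: real)"
      using R by (intro Bochner_Integration.integral_add integrable_real_indicator)
        (auto simp: emeasure_eq_measure)
    then show ?thesis using R by (simp add: prob_space phi_def R_def)
  qed
  finally show ?thesis using g(2) int_g int_gS by (simp add: gS)
qed

end

lemma prob_space_if_standard:
  assumes "standard_prob_space M"
  shows "prob_space M"
proof (rule prob_spaceI)
  obtain f :: "'a \<Rightarrow> real" where iso: "measure_iso M (restrict_space lborel {0..1}) f"
    using assms unfolding standard_prob_space_def ..
  have f: "f \<in> measurable M (restrict_space lborel {0..1})"
    "distr M (restrict_space lborel {0..1}) f = restrict_space lborel {0..1}"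
    using iso unfolding measure_iso_def borel_iso_def by blast+
  have "{0..1} \<in> sets (restrict_space lborel {0..1 :: real})"
    by (simp add: sets_restrict_space_iff)
  moreover have "f -` {0..1} \<inter> space M = space M"
    using measurable_space[OF f(1)] by (auto simp: space_restrict_space)
  ultimately have "emeasure M (space M) = emeasure (distr M (restrict_space lborel {0..1}) f) {0..1}"
    using emeasure_distr[OF f(1), of "{0..1}"] by simp
  also have "\<dots> = 1" unfolding f(2) by (simp add: emeasure_restrict_space)
  finally show "emeasure M (space M) = 1" .
qed

lemma Restr_eq_if_has_index_le_one:
  assumes E: "E \<subseteq> F" "equiv X E" and A: "A \<subseteq> X"
    and F: "trans F"
    and index: "has_index A (Restr F A) (Restr E A) m" "m \<le> 1"
  shows "Restr F A = Restr E A"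
proof (rule Set.equalityI)
  show "Restr E A \<subseteq> Restr F A" using E by blast
  show "Restr F A \<subseteq> Restr E A"
  proof (rule subrelI)
    fix x y assume "(x, y) \<in> Restr F A"
    then have xy: "(x, y) \<in> F" "x \<in> A" "y \<in> A" by auto
    let ?D = "{D \<in> A // Restr E A. D \<subseteq> Restr F A `` {x}}"
    have "Restr F A `` {x} \<in> A // Restr F A" using xy by (intro quotientI)
    then have "finite ?D" "card ?D \<le> Suc 0" using index by (auto simp: has_index_def)
    then have same: "D = D'" if "D \<in> ?D" "D' \<in> ?D" for D D'
      using that card_le_Suc0_iff_eq by blast
    have "Restr E A `` {x} \<in> ?D" using xy E by (auto intro: quotientI)
    moreover have "Restr E A `` {y} \<in> ?D"
    proof -
      have "(x, z) \<in> F" if "(y, z) \<in> E" for z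
        using transD[OF F xy(1)] E(1) that by blast
      then show ?thesis using xy by (auto intro: quotientI)
    qed
    ultimately have "Restr E A `` {x} = Restr E A `` {y}" by (rule same)
    moreover have "(y, y) \<in> E"
      using E(2) A xy(3) by (auto elim: equivE dest: refl_onD)
    ultimately show "(x, y) \<in> Restr E A" using xy by blast
  qed
qed

theorem theorem1:
  fixes M :: "'a measure"
    and G :: "('g, 'c) monoid_scheme"
    and act :: "'g \<Rightarrow> 'a \<Rightarrow> 'a"
    and F :: "'a rel"
  assumes "standard_prob_space M"
    and "group G" and "countable (carrier G)"
    and "mp_action G M act"
    and F_def: "F = orbit_equiv G M act"
  shows
    "(\<forall>E \<phi>0. borel_equiv M E \<and> E \<subseteq> F \<and>
        \<phi>0 = (INF g\<in>carrier G. phi M E (act g)) \<and> \<phi>0 > 0 \<longrightarrow>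
        (\<exists>A\<in>sets M. measure M A > 0 \<and> E `` A \<subseteq> A \<and>
           (\<exists>m::nat. has_index A (Restr F A) (Restr E A) m \<and> real m \<le> 1 / \<phi>0) \<and>
           (\<phi>0 > 1 / 2 \<longrightarrow> Restr F A = Restr E A)))
   \<and> (\<forall>E (\<epsilon>::real). borel_equiv M E \<and> countable_equiv M E \<and> mp_equiv M E \<and> \<epsilon> > 0 \<and>
        (\<forall>g\<in>carrier G. phi M E (act g) \<ge> 1 - \<epsilon>) \<longrightarrow>
        (\<forall>S\<in>full_group M F. phi M E S \<ge> 1 - 4 * \<epsilon>))"
proof -
  have loc: "pmp_action_with_relation M G act E" if "borel_equiv M E" for E
    using assms that prob_space_if_standard
    by (auto simp: pmp_action_with_relation_def pmp_action_with_relation_axioms_def mp_action_def)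
  show ?thesis
  proof (intro conjI allI impI)
    fix E :: "'a rel" and \<phi>0 :: real
    assume E: "borel_equiv M E \<and> E \<subseteq> F \<and>
        \<phi>0 = (INF g\<in>carrier G. phi M E (act g)) \<and> \<phi>0 > 0"
    then interpret pmp_action_with_relation M G act E using loc by blast
    have lower: "\<forall>h\<in>carrier G. \<phi>0 \<le> phi M E (act h)"
    proof
      fix h assume "h \<in> carrier G"
      have "bdd_below ((\<lambda>g. phi M E (act g)) ` carrier G)"
        by (intro bdd_belowI[of _ 0]) (auto simp: phi_def)
      with \<open>h \<in> carrier G\<close> E show "\<phi>0 \<le> phi M E (act h)" by (auto intro: cINF_lower)
    qed
    have sub: "E \<subseteq> orbit_equiv G M act" and pos: "0 < \<phi>0" using E F_def by auto
    obtain A m where A: "A \<in> sets M" "0 < measure M A" "E `` A \<subseteq> A"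
      "has_index A (Restr F A) (Restr E A) m" "real m \<le> 1 / \<phi>0"
      unfolding F_def by (rule finite_index_piece[OF sub lower pos])
    have eq: "Restr F A = Restr E A" if "\<phi>0 > 1 / 2"
    proof (rule Restr_eq_if_has_index_le_one)
      have "1 / \<phi>0 < 2" using that by (simp add: field_simps)
      then show "m \<le> 1" using A(5) by linarith
      show "A \<subseteq> space M" using A(1) by (rule sets.sets_into_space)
      show "trans F"
      proof (rule transI)
        fix x y z assume "(x, y) \<in> F" "(y, z) \<in> F"
        then show "(x, z) \<in> F" using orbit_eqI[of x y] by (simp add: F_def orbit_equiv_iff)
      qed
      show "E \<subseteq> F" using E by simp
    qed (rule equiv_E A(4))+
    show "\<exists>A\<in>sets M. measure M A > 0 \<and> E `` A \<subseteq> A \<and>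
           (\<exists>m::nat. has_index A (Restr F A) (Restr E A) m \<and> real m \<le> 1 / \<phi>0) \<and>
           (\<phi>0 > 1 / 2 \<longrightarrow> Restr F A = Restr E A)"
      by (intro bexI[of _ A] conjI exI[of _ m] impI A eq)
  next
    fix E :: "'a rel" and \<epsilon> :: real
    assume E: "borel_equiv M E \<and> countable_equiv M E \<and> mp_equiv M E \<and> \<epsilon> > 0 \<and>
        (\<forall>g\<in>carrier G. phi M E (act g) \<ge> 1 - \<epsilon>)"
    then interpret pmp_action_with_relation M G act E using loc by blast
    have "1 - 2 * \<epsilon> \<le> phi M E S" if "S \<in> full_group M F" for S
    proof (rule full_group_phi_ge)
      show "\<forall>g\<in>carrier G. 1 - \<epsilon> \<le> phi M E (act g)" using E by simp
      show "S \<in> full_group M (orbit_equiv G M act)" using that by (simp add: F_def)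
    qed
    moreover have "1 - 4 * \<epsilon> \<le> 1 - 2 * \<epsilon>" using E by simp
    ultimately show "\<forall>S\<in>full_group M F. phi M E S \<ge> 1 - 4 * \<epsilon>"
      by (blast intro: order_trans)
  qed
qed

end
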